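(* Let $(X,u)$ and $(Y,v)$ be two solutions. Let $Z=X\sqcup Y$ be the disjoint union, let $f,\alpha:X\to X$ and $g,\beta:Y\to Y$ be maps, and define $r:Z\times Z\to Z\times Z$ by $$r(a,b)=\begin{cases}u(a,b)&\text{if }a,b\in X,\\ v(a,b)&\text{if }a,b\in Y,\\ (g(b),f(a))&\text{if }a\in X,\ b\in Y,\\ (\alpha(b),\beta(a))&\text{if }a\in Y,\ b\in X,\end{cases}$$ for all $a,b\in Z$. Then $(Z,r)$ is a solution if and only if, for all $x\in X$ and $y\in Y$, the following hold: - $\alpha f=f\alpha$ and $g\beta=\beta g$; - $(f\times f)u=u(f\times f)$ and $(g\times g)v=v(g\times g)$; - $(\alpha\times\alpha)u=u(\alpha\times\alpha)$ and $(\beta\times\beta)v=v(\beta\times\beta)$; - $\alpha\lambda_{f(x)}=\lambda_x\alpha$ and $\beta\rho_{g(y)}=\rho_y\beta$; - $f\rho_{\alpha(x)}=\rho_xf$ and $g\lambda_{\beta(y)}=\lambda_yg$. The pair $(Z,r)$ is called the twisted union of $(X,u)$ and $(Y,v)$ via $f,\alpha$ and $g,\beta$.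
   Context: A (set-theoretic) solution (of the Yang-Baxter equation) is a pair $(X,r)$ with $X$ a set and $r:X\times X\to X\times X$ a map satisfying $(r\times \mathrm{id}_X)(\mathrm{id}_X\times r)(r\times \mathrm{id}_X)=(\mathrm{id}_X\times r)(r\times \mathrm{id}_X)(\mathrm{id}_X\times r)$. For the solutions $(X,u)$ and $(Y,v)$ write $u(x,x')=(\lambda_x(x'),\rho_{x'}(x))$ for $x,x'\in X$ and $v(y,y')=(\lambda_y(y'),\rho_{y'}(y))$ for $y,y'\in Y$; thus $\lambda_x,\rho_x:X\to X$ for $x\in X$ come from $u$ and $\lambda_y,\rho_y:Y\to Y$ for $y\in Y$ come from $v$. Juxtaposition of maps denotes composition. *)

theory Defs
  imports Main "HOL-Library.FuncSet"
begin

text \<open>The maps r \<times> id and id \<times> r, both on triples nested to the right.\<close>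

definition ybe_left :: "('a \<times> 'a \<Rightarrow> 'a \<times> 'a) \<Rightarrow> 'a \<times> 'a \<times> 'a \<Rightarrow> 'a \<times> 'a \<times> 'a" where
  "ybe_left r = (\<lambda>(x, y, z). case r (x, y) of (a, b) \<Rightarrow> (a, b, z))"

definition ybe_right :: "('a \<times> 'a \<Rightarrow> 'a \<times> 'a) \<Rightarrow> 'a \<times> 'a \<times> 'a \<Rightarrow> 'a \<times> 'a \<times> 'a" where
  "ybe_right r = map_prod id r"

text \<open>The carrier X may be empty, and only the values of r on X matter.\<close>

definition ybe_solution :: "'a set \<Rightarrow> ('a \<times> 'a \<Rightarrow> 'a \<times> 'a) \<Rightarrow> bool" where
  "ybe_solution X r \<longleftrightarrow>
     r \<in> X \<times> X \<rightarrow> X \<times> X \<and>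
     (\<forall>t \<in> X \<times> X \<times> X.
        (ybe_left r \<circ> ybe_right r \<circ> ybe_left r) t = (ybe_right r \<circ> ybe_left r \<circ> ybe_right r) t)"

text \<open>The components of r(x, x') = (\<lambda>_x(x'), \<rho>_{x'}(x)); the subscript is the argument
  following r in lam and rho, so that rho takes the entries of the pair in reverse order.\<close>

definition lam :: "('a \<times> 'a \<Rightarrow> 'a \<times> 'a) \<Rightarrow> 'a \<Rightarrow> 'a \<Rightarrow> 'a" where
  "lam r x x' = fst (r (x, x'))"

definition rho :: "('a \<times> 'a \<Rightarrow> 'a \<times> 'a) \<Rightarrow> 'a \<Rightarrow> 'a \<Rightarrow> 'a" where
  "rho r x' x = snd (r (x, x'))"

fun twisted_union ::
  "('a \<times> 'a \<Rightarrow> 'a \<times> 'a) \<Rightarrow> ('b \<times> 'b \<Rightarrow> 'b \<times> 'b) \<Rightarrow>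
   ('a \<Rightarrow> 'a) \<Rightarrow> ('a \<Rightarrow> 'a) \<Rightarrow> ('b \<Rightarrow> 'b) \<Rightarrow> ('b \<Rightarrow> 'b) \<Rightarrow>
   ('a + 'b) \<times> ('a + 'b) \<Rightarrow> ('a + 'b) \<times> ('a + 'b)" where
  "twisted_union u v f \<alpha> g \<beta> (Inl a, Inl b) = map_prod Inl Inl (u (a, b))"
| "twisted_union u v f \<alpha> g \<beta> (Inr a, Inr b) = map_prod Inr Inr (v (a, b))"
| "twisted_union u v f \<alpha> g \<beta> (Inl a, Inr b) = (Inr (g b), Inl (f a))"
| "twisted_union u v f \<alpha> g \<beta> (Inr a, Inl b) = (Inl (\<alpha> b), Inr (\<beta> a))"

end

theory Submission
  imports Defs
begin

text \<open>The braid equation for the twisted union is pointwise, and there are eight kinds of triples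
  according to the part in which each entry lies. Exchanging two entries from different parts keeps
  each of them in its part, so both sides of the equation reverse the pattern of parts and it
  remains to compare coordinates. On pure triples the equation is that of \<open>u\<close> or
  \<open>v\<close>. If the two entries from one part are adjacent, the third entry moves past them and acts on
  them by \<open>f\<close>, \<open>\<alpha>\<close>, \<open>g\<close> or \<open>\<beta>\<close>, before \<open>u\<close> or \<open>v\<close> is applied on one side of the equation and
  afterwards on the other; this says that the acting map commutes with the solution. If the odd
  entry is in the middle, the three coordinates of the equation give one condition on
  \<open>\<lambda>\<close>, one commutation of \<open>f\<close> with \<open>\<alpha>\<close> or of \<open>g\<close> with \<open>\<beta>\<close>, and one condition on \<open>\<rho>\<close>. All of
  these are equivalences, so both directions of the claim follow by collecting them.

  The quantification over both \<open>x \<in> X\<close> and \<open>y \<in> Y\<close> matters when a part is empty: there are then no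
  mixed triples, and the conditions hold vacuously.\<close>

definition braid_at :: "('a \<times> 'a \<Rightarrow> 'a \<times> 'a) \<Rightarrow> 'a \<times> 'a \<times> 'a \<Rightarrow> bool" where
  "braid_at r t \<longleftrightarrow>
     (ybe_left r \<circ> ybe_right r \<circ> ybe_left r) t = (ybe_right r \<circ> ybe_left r \<circ> ybe_right r) t"

lemma ybe_solution_iff_braid_at:
  "ybe_solution X r \<longleftrightarrow> r \<in> X \<times> X \<rightarrow> X \<times> X \<and>
     (\<forall>a \<in> X. \<forall>b \<in> X. \<forall>c \<in> X. braid_at r (a, b, c))"
  by (auto simp: ybe_solution_def braid_at_def)

lemmas braid_simps = braid_at_def ybe_left_def ybe_right_def lam_def rho_def

lemma twisted_union_in_carrier:
  assumes "u \<in> X \<times> X \<rightarrow> X \<times> X" and "v \<in> Y \<times> Y \<rightarrow> Y \<times> Y"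
    and "f \<in> X \<rightarrow> X" and "\<alpha> \<in> X \<rightarrow> X" and "g \<in> Y \<rightarrow> Y" and "\<beta> \<in> Y \<rightarrow> Y"
  shows "twisted_union u v f \<alpha> g \<beta> \<in> (X <+> Y) \<times> (X <+> Y) \<rightarrow> (X <+> Y) \<times> (X <+> Y)"
proof -
  have "map_prod Inl Inl (u (a, b)) \<in> (X <+> Y) \<times> (X <+> Y)" if "a \<in> X" "b \<in> X" for a b
    using assms(1) that by (cases "u (a, b)") (force simp: Pi_iff)
  moreover have "map_prod Inr Inr (v (a, b)) \<in> (X <+> Y) \<times> (X <+> Y)" if "a \<in> Y" "b \<in> Y" for a b
    using assms(2) that by (cases "v (a, b)") (force simp: Pi_iff)
  ultimately show ?thesis
    using assms(3-) by (auto simp: Pi_iff)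
qed

context
  fixes u :: "'a \<times> 'a \<Rightarrow> 'a \<times> 'a" and v :: "'b \<times> 'b \<Rightarrow> 'b \<times> 'b"
    and f \<alpha> :: "'a \<Rightarrow> 'a" and g \<beta> :: "'b \<Rightarrow> 'b"
begin

private abbreviation (input) "r \<equiv> twisted_union u v f \<alpha> g \<beta>"

lemma braid_at_XXX: "braid_at r (Inl a, Inl b, Inl c) \<longleftrightarrow> braid_at u (a, b, c)"
  by (auto simp: braid_simps split_beta map_prod_def prod_eq_iff)

lemma braid_at_YYY: "braid_at r (Inr a, Inr b, Inr c) \<longleftrightarrow> braid_at v (a, b, c)"
  by (auto simp: braid_simps split_beta map_prod_def prod_eq_iff)

text \<open>A foreign entry that starts on the right moves to the left past both adjacent entries, acting
  on each of them by \<open>f\<close> or \<open>\<beta>\<close>; one that starts on the left acts by \<open>\<alpha>\<close> or \<open>g\<close>. It is itself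
  changed in the same way on both sides of the equation and so contributes no condition.\<close>

lemma braid_at_XXY:
  "braid_at r (Inl a, Inl b, Inr y) \<longleftrightarrow> (map_prod f f \<circ> u) (a, b) = (u \<circ> map_prod f f) (a, b)"
  by (auto simp: braid_simps split_beta map_prod_def prod_eq_iff)

lemma braid_at_YXX:
  "braid_at r (Inr y, Inl a, Inl b) \<longleftrightarrow> (map_prod \<alpha> \<alpha> \<circ> u) (a, b) = (u \<circ> map_prod \<alpha> \<alpha>) (a, b)"
  by (auto simp: braid_simps split_beta map_prod_def prod_eq_iff)

lemma braid_at_YYX:
  "braid_at r (Inr a, Inr b, Inl x) \<longleftrightarrow> (map_prod \<beta> \<beta> \<circ> v) (a, b) = (v \<circ> map_prod \<beta> \<beta>) (a, b)"
  by (auto simp: braid_simps split_beta map_prod_def prod_eq_iff)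

lemma braid_at_XYY:
  "braid_at r (Inl x, Inr a, Inr b) \<longleftrightarrow> (map_prod g g \<circ> v) (a, b) = (v \<circ> map_prod g g) (a, b)"
  by (auto simp: braid_simps split_beta map_prod_def prod_eq_iff)

text \<open>On one side of the equation the middle entry first moves to the left, and the outer entries meet
  after \<open>f\<close> (or \<open>\<beta>\<close>) has acted on the left one; on the other side it first moves to the right, and
  they meet after \<open>\<alpha>\<close> (or \<open>g\<close>) has acted on the right one. The remaining map acts last.\<close>

lemma braid_at_XYX:
  "braid_at r (Inl a, Inr y, Inl b) \<longleftrightarrow>
     (\<alpha> \<circ> lam u (f a)) b = (lam u a \<circ> \<alpha>) b \<and> (g \<circ> \<beta>) y = (\<beta> \<circ> g) y \<and>
     (f \<circ> rho u (\<alpha> b)) a = (rho u b \<circ> f) a"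
  by (auto simp: braid_simps split_beta map_prod_def prod_eq_iff)

lemma braid_at_YXY:
  "braid_at r (Inr a, Inl x, Inr b) \<longleftrightarrow>
     (g \<circ> lam v (\<beta> a)) b = (lam v a \<circ> g) b \<and> (\<alpha> \<circ> f) x = (f \<circ> \<alpha>) x \<and>
     (\<beta> \<circ> rho v (g b)) a = (rho v b \<circ> \<beta>) a"
  by (auto simp: braid_simps split_beta map_prod_def prod_eq_iff)

end

theorem proposition5p9:
  fixes X :: "'a set" and Y :: "'b set"
    and u :: "'a \<times> 'a \<Rightarrow> 'a \<times> 'a" and v :: "'b \<times> 'b \<Rightarrow> 'b \<times> 'b"
    and f \<alpha> :: "'a \<Rightarrow> 'a" and g \<beta> :: "'b \<Rightarrow> 'b"
  assumes "ybe_solution X u" and "ybe_solution Y v"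
    and "f \<in> X \<rightarrow> X" and "\<alpha> \<in> X \<rightarrow> X" and "g \<in> Y \<rightarrow> Y" and "\<beta> \<in> Y \<rightarrow> Y"
  shows "ybe_solution (X <+> Y) (twisted_union u v f \<alpha> g \<beta>) \<longleftrightarrow>
    (\<forall>x \<in> X. \<forall>y \<in> Y.
      (\<forall>a \<in> X. (\<alpha> \<circ> f) a = (f \<circ> \<alpha>) a) \<and>
      (\<forall>b \<in> Y. (g \<circ> \<beta>) b = (\<beta> \<circ> g) b) \<and>
      (\<forall>p \<in> X \<times> X. (map_prod f f \<circ> u) p = (u \<circ> map_prod f f) p) \<and>
      (\<forall>q \<in> Y \<times> Y. (map_prod g g \<circ> v) q = (v \<circ> map_prod g g) q) \<and>
      (\<forall>p \<in> X \<times> X. (map_prod \<alpha> \<alpha> \<circ> u) p = (u \<circ> map_prod \<alpha> \<alpha>) p) \<and>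
      (\<forall>q \<in> Y \<times> Y. (map_prod \<beta> \<beta> \<circ> v) q = (v \<circ> map_prod \<beta> \<beta>) q) \<and>
      (\<forall>a \<in> X. (\<alpha> \<circ> lam u (f x)) a = (lam u x \<circ> \<alpha>) a) \<and>
      (\<forall>b \<in> Y. (\<beta> \<circ> rho v (g y)) b = (rho v y \<circ> \<beta>) b) \<and>
      (\<forall>a \<in> X. (f \<circ> rho u (\<alpha> x)) a = (rho u x \<circ> f) a) \<and>
      (\<forall>b \<in> Y. (g \<circ> lam v (\<beta> y)) b = (lam v y \<circ> g) b))"
proof -
  let ?r = "twisted_union u v f \<alpha> g \<beta>"
  have ball_Plus: "(\<forall>z \<in> X <+> Y. P z) \<longleftrightarrow> (\<forall>x \<in> X. P (Inl x)) \<and> (\<forall>y \<in> Y. P (Inr y))" for P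
    by blast
  have u: "u \<in> X \<times> X \<rightarrow> X \<times> X" "\<forall>a \<in> X. \<forall>b \<in> X. \<forall>c \<in> X. braid_at u (a, b, c)"
    and v: "v \<in> Y \<times> Y \<rightarrow> Y \<times> Y" "\<forall>a \<in> Y. \<forall>b \<in> Y. \<forall>c \<in> Y. braid_at v (a, b, c)"
    using assms(1,2) by (simp_all add: ybe_solution_iff_braid_at)
  have "ybe_solution (X <+> Y) ?r \<longleftrightarrow>
    (\<forall>a \<in> X <+> Y. \<forall>b \<in> X <+> Y. \<forall>c \<in> X <+> Y. braid_at ?r (a, b, c))"
    using twisted_union_in_carrier[OF u(1) v(1) assms(3-6)]
    by (simp add: ybe_solution_iff_braid_at)
  also have "\<dots> \<longleftrightarrow>
    (\<forall>a \<in> X. \<forall>b \<in> X. \<forall>y \<in> Y. braid_at ?r (Inl a, Inl b, Inr y)) \<and>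
    (\<forall>a \<in> X. \<forall>y \<in> Y. \<forall>b \<in> X. braid_at ?r (Inl a, Inr y, Inl b)) \<and>
    (\<forall>y \<in> Y. \<forall>a \<in> X. \<forall>b \<in> X. braid_at ?r (Inr y, Inl a, Inl b)) \<and>
    (\<forall>x \<in> X. \<forall>a \<in> Y. \<forall>b \<in> Y. braid_at ?r (Inl x, Inr a, Inr b)) \<and>
    (\<forall>a \<in> Y. \<forall>x \<in> X. \<forall>b \<in> Y. braid_at ?r (Inr a, Inl x, Inr b)) \<and>
    (\<forall>a \<in> Y. \<forall>b \<in> Y. \<forall>x \<in> X. braid_at ?r (Inr a, Inr b, Inl x))"
    using u(2) v(2)
    by (simp add: ball_Plus ball_conj_distrib braid_at_XXX braid_at_YYY conj_ac)
  finally show ?thesis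
    unfolding braid_at_XXY braid_at_XYX braid_at_YXX braid_at_XYY braid_at_YXY braid_at_YYX
      split_paired_Ball_Sigma
    by blast
qed

end
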